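(* There are absolute positive constants (implicit in the $O(\cdot)$ and $\Omega(\cdot)$ below) such that for every sufficiently small $\rho,\gamma>0$ the following holds for all sufficiently large $d$. There exists a family of $2^{d^{O(1)}}$ pairs of probability distributions $(\widetilde D_0,\widetilde D_1)$ over $\mathbb{R}^d$ such that: (1) for every pair in the family, almost all the mass of $\widetilde D_0$ and of $\widetilde D_1$ (that is, mass $1-o(1)$ as $d\to\infty$) is supported in an $\ell_2$-ball of radius $O(\sqrt d)$; (2) every pair $(\widetilde D_0,\widetilde D_1)$ in the family admits an $(\Omega(\sqrt{1/\gamma}),\,2^{-d^{\Omega(\gamma)}})$-robust classifier; moreover, the family is $(\Omega(\sqrt{1/\gamma}),0.01)$-robustly learnable with $O(d)$ samples; (3) for every pair $(\widetilde D_0,\widetilde D_1)$ in the family there exists a linear (non-robust) classifier separating $\widetilde D_0$ from $\widetilde D_1$, and such a classifier can be learned from samples in time polynomial in $d$; (4) for every $\epsilon>\rho$, any statistical query algorithm which, for every pair $(\widetilde D_0,\widetilde D_1)$ in the family, learns an $(\epsilon,0.01)$-robust classifier for $(\widetilde D_0,\widetilde D_1)$ must make at least $2^{d^{\Omega(1)}}$ statistical queries, even if the precision of the queries is as good as $\tau=2^{-d^{\Omega(\gamma)}}$.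
   Context: All robustness is with respect to the Euclidean norm $\|\cdot\|=\|\cdot\|_2$ on $\mathbb{R}^d$; $B(\epsilon)=\{z\in\mathbb{R}^d:\|z\|\le\epsilon\}$. For $f:\mathbb{R}^d\to\{0,1\}$ and $(x,i)\in\mathbb{R}^d\times\{0,1\}$, the $\epsilon$-robust zero-one loss is $\ell_\epsilon(f,x,i)=\mathbf 1\{\exists z\in B(\epsilon): f(x+z)\ne i\}$. A classifier $f:\mathbb{R}^d\to\{0,1\}$ is $(\epsilon,\delta)$-robust for a pair of distributions $(D_0,D_1)$ if $\mathbb{E}_{X\sim D_i}[\ell_\epsilon(f,X,i)]\le\delta$ for each $i\in\{0,1\}$. A non-robust classifier corresponds to $\epsilon=0$. A linear classifier is a function of the form $x\mapsto \mathbf 1\{\langle w,x\rangle\ge b\}$; it separates $D_0$ from $D_1$ if it is $(0,0)$-robust for $(D_0,D_1)$. A family $\mathcal D$ of pairs of distributions is $(\epsilon,\delta)$-robustly learnable with $n$ samples if there is an algorithm which, given $n$ i.i.d. samples from $D_0$ and $n$ i.i.d. samples from $D_1$, outputs for every $(D_0,D_1)\in\mathcal D$, with probability at least $2/3$, a classifier that is $(\epsilon,\delta)$-robust for $(D_0,D_1)$ (no computational restriction). Statistical query (SQ) model: the algorithm accesses $(D_0,D_1)$ only through queries. A query is a function $h:\mathbb{R}^d\to[0,1]$; the response of an oracle of precision $\tau>0$ is a pair of numbers $u,v\in\mathbb{R}$ with $|u-\mathbb{E}_{x\sim D_0}[h(x)]|\le\tau$ and $|v-\mathbb{E}_{x\sim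 D_1}[h(x)]|\le\tau$ (the oracle may answer with any such numbers). After asking a number of (possibly adaptive) queries, the algorithm must output a classifier. The algorithm learns an $(\epsilon,0.01)$-robust classifier if its output is $(\epsilon,0.01)$-robust for $(D_0,D_1)$ with probability at least $2/3$ whatever valid responses the oracle gives. *)

theory Defs
  imports "HOL-Probability.Probability"
begin

section \<open>Euclidean space, robustness and linear classifiers\<close>

text \<open>
  The dimension \<open>d\<close> is quantified inside the statement, so points of \<open>\<real>\<^sup>d\<close> are extensional functions
  on \<open>{..<d}\<close>.  The label set \<open>{0, 1}\<close> is \<^typ>\<open>bool\<close>, with \<open>0 = False\<close> and \<open>1 = True\<close>; a pair
  \<open>(D\<^sub>0, D\<^sub>1)\<close> is the function \<open>D\<close> with \<open>D False = D\<^sub>0\<close> and \<open>D True = D\<^sub>1\<close>.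
\<close>

type_synonym vec = "nat \<Rightarrow> real"
type_synonym classifier = "vec \<Rightarrow> bool"
type_synonym dist_pair = "bool \<Rightarrow> vec measure"

definition euclid :: "nat \<Rightarrow> vec measure" where
  "euclid d = (\<Pi>\<^sub>M i\<in>{..<d}. borel)"

definition vadd :: "nat \<Rightarrow> vec \<Rightarrow> vec \<Rightarrow> vec" where
  "vadd d x z = (\<lambda>i\<in>{..<d}. x i + z i)"

definition centered_ball :: "nat \<Rightarrow> real \<Rightarrow> vec set" where
  "centered_ball d \<epsilon> = {z \<in> space (euclid d). L2_set z {..<d} \<le> \<epsilon>}"

definition is_dist_pair :: "nat \<Rightarrow> dist_pair \<Rightarrow> bool" where
  "is_dist_pair d D \<longleftrightarrow> (\<forall>i. prob_space (D i) \<and> sets (D i) = sets (euclid d))"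

definition robust_loss :: "nat \<Rightarrow> real \<Rightarrow> classifier \<Rightarrow> vec \<Rightarrow> bool \<Rightarrow> real" where
  "robust_loss d \<epsilon> f x i = of_bool (\<exists>z\<in>centered_ball d \<epsilon>. f (vadd d x z) \<noteq> i)"

text \<open>
  For a Borel classifier the loss event is the projection of a Borel set: it is analytic, hence
  universally measurable, but need not be Borel.  Therefore the expectation is taken with respect to
  the completed measure; the integrability conjunct says that this expectation exists.
\<close>

definition is_robust :: "nat \<Rightarrow> real \<Rightarrow> real \<Rightarrow> dist_pair \<Rightarrow> classifier \<Rightarrow> bool" where
  "is_robust d \<epsilon> \<delta> D f \<longleftrightarrow>
     (\<forall>i. integrable (completion (D i)) (\<lambda>x. robust_loss d \<epsilon> f x i) \<and>
          (\<integral>x. robust_loss d \<epsilon> f x i \<partial>completion (D i)) \<le> \<delta>)"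

definition linear_classifier :: "nat \<Rightarrow> vec \<Rightarrow> real \<Rightarrow> classifier" where
  "linear_classifier d w b = (\<lambda>x. (\<Sum>i<d. w i * x i) \<ge> b)"

definition separates :: "nat \<Rightarrow> dist_pair \<Rightarrow> classifier \<Rightarrow> bool" where
  "separates d D f \<longleftrightarrow> is_robust d 0 0 D f"


section \<open>Learning from samples\<close>

text \<open>
  Inner probability: it agrees with the probability of \<open>{\<omega>. P \<omega>}\<close> when that event is measurable, and
  does not force an algorithm to be measurable otherwise.
\<close>

definition holds_with_prob :: "'a measure \<Rightarrow> real \<Rightarrow> ('a \<Rightarrow> bool) \<Rightarrow> bool" where
  "holds_with_prob M p P \<longleftrightarrow> (\<exists>E\<in>sets M. p \<le> measure M E \<and> (\<forall>\<omega>\<in>E. P \<omega>))"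

text \<open>The internal randomness of every algorithm is an infinite sequence of fair coin flips.\<close>

type_synonym coins = "nat \<Rightarrow> bool"

definition coin_space :: "coins measure" where
  "coin_space = (\<Pi>\<^sub>M k\<in>UNIV. measure_pmf (bernoulli_pmf (1/2)))"

text \<open>\<open>s (i, j)\<close> is the \<open>j\<close>-th of the \<open>n\<close> independent samples from \<open>D i\<close>.\<close>

type_synonym samples = "bool \<times> nat \<Rightarrow> vec"

definition sample_space :: "dist_pair \<Rightarrow> nat \<Rightarrow> samples measure" where
  "sample_space D n = (\<Pi>\<^sub>M (i, j)\<in>UNIV \<times> {..<n}. D i)"

definition robustly_learnable :: "nat \<Rightarrow> real \<Rightarrow> real \<Rightarrow> dist_pair set \<Rightarrow> nat \<Rightarrow> bool" where
  "robustly_learnable d \<epsilon> \<delta> F n \<longleftrightarrow>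
     (\<exists>A :: coins \<Rightarrow> samples \<Rightarrow> classifier. \<forall>D\<in>F.
        holds_with_prob (coin_space \<Otimes>\<^sub>M sample_space D n) (2/3)
          (\<lambda>(\<omega>, s). is_robust d \<epsilon> \<delta> D (A \<omega> s)))"


section \<open>Polynomial time: a real random access machine\<close>

text \<open>
  Samples are real vectors, so running time is counted on a uniform real RAM with unit cost per
  instruction.  Index registers hold natural numbers, with addition and truncated subtraction only;
  real memory cells are addressed indirectly, through index registers; there is exact real
  arithmetic with comparison (no rounding), only rational constants, read access to the samples, and
  coin flips.
\<close>

datatype instr =
    ISet nat nat
  | IAdd nat nat nat
  | ISub nat nat nat
  | IJumpLess nat nat nat
  | RSet nat rat
  | RAdd nat nat nat
  | RSub nat nat nat
  | RMul nat nat nat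
  | RDiv nat nat nat
  | RJumpLess nat nat nat
  | ReadSample bool nat nat nat
  | Flip nat

record ram_state =
  pc :: nat
  idx :: "nat \<Rightarrow> nat"
  mem :: "nat \<Rightarrow> real"
  flips :: nat

fun exec_instr ::
  "coins \<Rightarrow> (bool \<Rightarrow> nat \<Rightarrow> nat \<Rightarrow> real) \<Rightarrow> instr \<Rightarrow> ram_state \<Rightarrow> ram_state" where
  "exec_instr \<omega> inp (ISet a n) \<sigma> = \<sigma>\<lparr>pc := Suc (pc \<sigma>), idx := (idx \<sigma>)(a := n)\<rparr>"
| "exec_instr \<omega> inp (IAdd a b c) \<sigma> =
     \<sigma>\<lparr>pc := Suc (pc \<sigma>), idx := (idx \<sigma>)(a := idx \<sigma> b + idx \<sigma> c)\<rparr>"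
| "exec_instr \<omega> inp (ISub a b c) \<sigma> =
     \<sigma>\<lparr>pc := Suc (pc \<sigma>), idx := (idx \<sigma>)(a := idx \<sigma> b - idx \<sigma> c)\<rparr>"
| "exec_instr \<omega> inp (IJumpLess a b l) \<sigma> =
     \<sigma>\<lparr>pc := (if idx \<sigma> a < idx \<sigma> b then l else Suc (pc \<sigma>))\<rparr>"
| "exec_instr \<omega> inp (RSet a q) \<sigma> =
     \<sigma>\<lparr>pc := Suc (pc \<sigma>), mem := (mem \<sigma>)(idx \<sigma> a := of_rat q)\<rparr>"
| "exec_instr \<omega> inp (RAdd a b c) \<sigma> =
     \<sigma>\<lparr>pc := Suc (pc \<sigma>), mem := (mem \<sigma>)(idx \<sigma> a := mem \<sigma> (idx \<sigma> b) + mem \<sigma> (idx \<sigma> c))\<rparr>"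
| "exec_instr \<omega> inp (RSub a b c) \<sigma> =
     \<sigma>\<lparr>pc := Suc (pc \<sigma>), mem := (mem \<sigma>)(idx \<sigma> a := mem \<sigma> (idx \<sigma> b) - mem \<sigma> (idx \<sigma> c))\<rparr>"
| "exec_instr \<omega> inp (RMul a b c) \<sigma> =
     \<sigma>\<lparr>pc := Suc (pc \<sigma>), mem := (mem \<sigma>)(idx \<sigma> a := mem \<sigma> (idx \<sigma> b) * mem \<sigma> (idx \<sigma> c))\<rparr>"
| "exec_instr \<omega> inp (RDiv a b c) \<sigma> =
     \<sigma>\<lparr>pc := Suc (pc \<sigma>), mem := (mem \<sigma>)(idx \<sigma> a := mem \<sigma> (idx \<sigma> b) / mem \<sigma> (idx \<sigma> c))\<rparr>"
| "exec_instr \<omega> inp (RJumpLess a b l) \<sigma> =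
     \<sigma>\<lparr>pc := (if mem \<sigma> (idx \<sigma> a) < mem \<sigma> (idx \<sigma> b) then l else Suc (pc \<sigma>))\<rparr>"
| "exec_instr \<omega> inp (ReadSample i a j k) \<sigma> =
     \<sigma>\<lparr>pc := Suc (pc \<sigma>), mem := (mem \<sigma>)(idx \<sigma> a := inp i (idx \<sigma> j) (idx \<sigma> k))\<rparr>"
| "exec_instr \<omega> inp (Flip a) \<sigma> =
     \<sigma>\<lparr>pc := Suc (pc \<sigma>), idx := (idx \<sigma>)(a := of_bool (\<omega> (flips \<sigma>))), flips := Suc (flips \<sigma>)\<rparr>"

definition ram_step ::
  "instr list \<Rightarrow> coins \<Rightarrow> (bool \<Rightarrow> nat \<Rightarrow> nat \<Rightarrow> real) \<Rightarrow> ram_state \<Rightarrow> ram_state" where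
  "ram_step prog \<omega> inp \<sigma> =
     (if pc \<sigma> < length prog then exec_instr \<omega> inp (prog ! pc \<sigma>) \<sigma> else \<sigma>)"

text \<open>Out-of-range reads give \<open>0\<close>, not the unspecified value of an extensional function.\<close>

definition sample_input :: "nat \<Rightarrow> nat \<Rightarrow> samples \<Rightarrow> bool \<Rightarrow> nat \<Rightarrow> nat \<Rightarrow> real" where
  "sample_input d n s i j k = (if j < n \<and> k < d then s (i, j) k else 0)"

definition ram_init :: "nat \<Rightarrow> ram_state" where
  "ram_init d = \<lparr>pc = 0, idx = (\<lambda>_. 0)(0 := d), mem = (\<lambda>_. 0), flips = 0\<rparr>"

definition ram_run ::
  "instr list \<Rightarrow> nat \<Rightarrow> nat \<Rightarrow> nat \<Rightarrow> coins \<Rightarrow> samples \<Rightarrow> ram_state" where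
  "ram_run prog d n T \<omega> s = (ram_step prog \<omega> (sample_input d n s) ^^ T) (ram_init d)"

text \<open>
  The output is read from cells \<open>0, \<dots>, d\<close>: the weight vector, then the threshold.  One program has to
  serve every dimension \<open>d \<ge> d\<^sub>0\<close>; it gets \<open>d\<close> as its only parameter, and \<open>d\<^sup>k\<close> bounds both the number
  of samples it may use from each distribution and its running time (the latter on every input).
\<close>

definition ram_output :: "nat \<Rightarrow> ram_state \<Rightarrow> classifier" where
  "ram_output d \<sigma> = linear_classifier d (mem \<sigma>) (mem \<sigma> d)"

definition separator_learnable_in_time ::
  "nat \<Rightarrow> nat \<Rightarrow> (nat \<Rightarrow> dist_pair set) \<Rightarrow> bool" where
  "separator_learnable_in_time k d\<^sub>0 F \<longleftrightarrow>
     (\<exists>prog :: instr list. \<forall>d\<ge>d\<^sub>0.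
        (\<forall>\<omega> s. pc (ram_run prog d (d ^ k) (d ^ k) \<omega> s) \<ge> length prog) \<and>
        (\<forall>D\<in>F d.
           holds_with_prob (coin_space \<Otimes>\<^sub>M sample_space D (d ^ k)) (2/3)
             (\<lambda>(\<omega>, s). separates d D (ram_output d (ram_run prog d (d ^ k) (d ^ k) \<omega> s)))))"


section \<open>Statistical query algorithms\<close>

type_synonym query = "vec \<Rightarrow> real"
type_synonym response = "bool \<Rightarrow> real"

definition is_query :: "nat \<Rightarrow> query \<Rightarrow> bool" where
  "is_query d h \<longleftrightarrow> h \<in> borel_measurable (euclid d) \<and> (\<forall>x\<in>space (euclid d). 0 \<le> h x \<and> h x \<le> 1)"

text \<open>
  An adaptive algorithm with its coins fixed is a well-founded decision tree, branching over all
  possible responses; a randomized algorithm is a function from coin sequences to such trees.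
\<close>

datatype sq_tree =
    Output classifier
  | Ask query "response \<Rightarrow> sq_tree"

primrec sq_tree_valid :: "nat \<Rightarrow> sq_tree \<Rightarrow> bool" where
  "sq_tree_valid d (Output f) \<longleftrightarrow> True"
| "sq_tree_valid d (Ask h next) \<longleftrightarrow> is_query d h \<and> (\<forall>r. sq_tree_valid d (next r))"

text \<open>
  An oracle may answer in any valid way, so its response may depend on the whole history: the
  argument lists all queries asked so far, the current one first.
\<close>

type_synonym oracle_strategy = "query list \<Rightarrow> response"

definition valid_oracle :: "nat \<Rightarrow> real \<Rightarrow> dist_pair \<Rightarrow> oracle_strategy \<Rightarrow> bool" where
  "valid_oracle d \<tau> D orc \<longleftrightarrow>
     (\<forall>h hs i. is_query d h \<longrightarrow> \<bar>orc (h # hs) i - (\<integral>x. h x \<partial>D i)\<bar> \<le> \<tau>)"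

primrec sq_run :: "oracle_strategy \<Rightarrow> query list \<Rightarrow> sq_tree \<Rightarrow> classifier" where
  "sq_run orc hs (Output f) = f"
| "sq_run orc hs (Ask h next) = sq_run orc (h # hs) (next (orc (h # hs)))"

primrec sq_count :: "oracle_strategy \<Rightarrow> query list \<Rightarrow> sq_tree \<Rightarrow> nat" where
  "sq_count orc hs (Output f) = 0"
| "sq_count orc hs (Ask h next) = Suc (sq_count orc (h # hs) (next (orc (h # hs))))"

definition sq_learns ::
  "nat \<Rightarrow> real \<Rightarrow> real \<Rightarrow> real \<Rightarrow> dist_pair set \<Rightarrow> (coins \<Rightarrow> sq_tree) \<Rightarrow> bool" where
  "sq_learns d \<tau> \<epsilon> \<delta> F A \<longleftrightarrow>
     (\<forall>D\<in>F. \<forall>orc. valid_oracle d \<tau> D orc \<longrightarrow>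
        holds_with_prob coin_space (2/3) (\<lambda>\<omega>. is_robust d \<epsilon> \<delta> D (sq_run orc [] (A \<omega>))))"

text \<open>
  A lower bound on the number of queries is a worst-case bound: some run on some pair of the family,
  with valid responses, uses at least \<open>N\<close> queries.
\<close>

definition sq_makes_at_least ::
  "nat \<Rightarrow> real \<Rightarrow> dist_pair set \<Rightarrow> (coins \<Rightarrow> sq_tree) \<Rightarrow> real \<Rightarrow> bool" where
  "sq_makes_at_least d \<tau> F A N \<longleftrightarrow>
     (\<exists>D\<in>F. \<exists>orc \<omega>. valid_oracle d \<tau> D orc \<and> N \<le> real (sq_count orc [] (A \<omega>)))"

end

theory Submission
  imports Defs
begin

text \<open>
  The hard family is a scaled noiseless parity.  A point carries a label coordinate \<open>\<plusminus>\<rho>/2\<close>, then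
  \<open>m \<approx> sqrt d\<close> uniform bits encoded as \<open>\<plusminus>R\<close> with \<open>R = d powr (1/4)\<close>, and one more coordinate \<open>\<plusminus>R\<close>
  whose sign is the label times the parity of the bits in a hidden set \<open>S\<close>.  The label coordinate is a
  linear separator with margin \<open>\<rho>/2\<close>, which a perturbation of size \<open>\<rho>\<close> erases.  Rounding and taking the
  parity over \<open>S\<close> is robust up to radius \<open>R\<close>, and a union bound over the \<open>2 ^ m\<close> parities shows that
  \<open>m + 2\<close> samples identify \<open>S\<close>.

  Whatever the query, the deviation of its expectation from that of the null model, where the last
  coordinate is an unbiased coin, is the Walsh coefficient at \<open>S\<close> of one bounded function per label.  By Parseval
  all but \<open>2 / \<tau>\<^sup>2\<close> sets \<open>S\<close> are consistent with the null answer.  Likewise one fixed classifier can be robust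
  for at most one \<open>S\<close>, so an algorithm with few queries fails on most of them.
\<close>

section \<open>Walsh functions\<close>

text \<open>The Fourier character of frequency \<open>S\<close> on bit strings, each string
  \<open>b\<close> being the set of its ones; by symmetry strings can also act as
  frequencies.\<close>

definition walsh :: "'a set \<Rightarrow> 'a set \<Rightarrow> real" where
  "walsh S b = (-1) ^ card (S \<inter> b)"

lemma walsh_commute: "walsh S b = walsh b S"
  by (simp add: walsh_def Int_commute)

lemma walsh_eq_prod: "finite b \<Longrightarrow> walsh S b = (\<Prod>i\<in>b. if i \<in> S then -1 else 1)"
  by (simp add: walsh_def prod.If_cases Int_commute)

lemma walsh_eq_if: "walsh S b = (if odd (card (S \<inter> b)) then -1 else 1)"
  by (simp add: walsh_def)

lemma walsh_square [simp]: "walsh S b * walsh S b = 1"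
  by (simp add: walsh_eq_if)

text \<open>The sum over all \<open>b\<close> factors into a product over \<open>I\<close> of terms
  \<open>?w i + 1\<close>; an index in exactly one of \<open>S\<close> and \<open>T\<close> makes
  its term \<open>-1 + 1 = 0\<close>.\<close>

lemma sum_walsh_orthogonal:
  assumes "finite I" "S \<subseteq> I" "T \<subseteq> I" "S \<noteq> T"
  shows "(\<Sum>b\<in>Pow I. walsh S b * walsh T b) = 0"
proof -
  let ?w = "\<lambda>i. (if i \<in> S then -1 else 1) * (if i \<in> T then -1 else 1) :: real"
  have "(\<Sum>b\<in>Pow I. walsh S b * walsh T b) = (\<Sum>b\<in>Pow I. (\<Prod>i\<in>b. ?w i) * (\<Prod>i\<in>I - b. 1))"
    using assms(1)
    by (intro sum.cong refl) (auto simp: walsh_eq_prod finite_subset prod.distrib)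
  also have "\<dots> = (\<Prod>i\<in>I. ?w i + 1)"
    by (rule prod_add[OF assms(1), symmetric])
  also have "\<dots> = 0"
  proof -
    obtain k where "k \<in> I" "(k \<in> S) \<noteq> (k \<in> T)"
      using assms by blast
    then show ?thesis
      using assms(1) by (intro prod_zero) auto
  qed
  finally show ?thesis .
qed

lemma sum_Pow_walsh_prod:
  assumes "finite I" "S \<subseteq> I" "T \<subseteq> I"
  shows "(\<Sum>b\<in>Pow I. walsh S b * walsh T b) = (if S = T then 2 ^ card I else 0)"
  using sum_walsh_orthogonal[OF assms] assms(1) by (auto simp: card_Pow)

text \<open>Expanding the square and summing over \<open>S\<close> first leaves only the diagonal,
  by orthogonality with the strings \<open>b\<close> and \<open>b'\<close> as frequencies.\<close>

lemma walsh_parseval: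
  assumes "finite I"
  shows "(\<Sum>S\<in>Pow I. (\<Sum>b\<in>Pow I. walsh S b * c b)\<^sup>2) = 2 ^ card I * (\<Sum>b\<in>Pow I. (c b)\<^sup>2)"
proof -
  have "(\<Sum>S\<in>Pow I. (\<Sum>b\<in>Pow I. walsh S b * c b)\<^sup>2)
      = (\<Sum>S\<in>Pow I. \<Sum>b\<in>Pow I. \<Sum>b'\<in>Pow I. c b * c b' * (walsh b S * walsh b' S))"
    by (simp add: power2_eq_square sum_product walsh_commute mult_ac)
  also have "\<dots> = (\<Sum>b\<in>Pow I. \<Sum>S\<in>Pow I. \<Sum>b'\<in>Pow I. c b * c b' * (walsh b S * walsh b' S))"
    by (rule sum.swap)
  also have "\<dots> = (\<Sum>b\<in>Pow I. \<Sum>b'\<in>Pow I. \<Sum>S\<in>Pow I. c b * c b' * (walsh b S * walsh b' S))"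
    by (rule sum.cong[OF refl], rule sum.swap)
  also have "\<dots> = (\<Sum>b\<in>Pow I. \<Sum>b'\<in>Pow I. c b * c b' * (if b = b' then 2 ^ card I else 0))"
    using assms
    by (intro sum.cong refl) (simp only: sum_distrib_left[symmetric] sum_Pow_walsh_prod Pow_iff)
  also have "\<dots> = (\<Sum>b\<in>Pow I. (c b)\<^sup>2 * 2 ^ card I)"
    using assms by (intro sum.cong refl) (simp add: if_distrib sum.delta' power2_eq_square cong: if_cong)
  finally show ?thesis
    by (simp add: sum_distrib_right[symmetric] mult.commute)
qed

text \<open>Markov's inequality on top of Parseval: the squared normalised coefficients sum to at
  most 1. It serves for query deviations (\<open>t = \<tau>\<close>) and for a fixed classifier
  (\<open>t = 9/10\<close>).\<close>

lemma card_large_walsh_coefficients: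
  assumes "finite I" "\<And>b. b \<subseteq> I \<Longrightarrow> \<bar>c b\<bar> \<le> 1" "t > 0"
  shows "real (card {S \<in> Pow I. t < \<bar>\<Sum>b\<in>Pow I. walsh S b * c b\<bar> / 2 ^ card I}) \<le> 1 / t\<^sup>2"
proof -
  let ?N = "2 ^ card I :: real"
  let ?L = "{S \<in> Pow I. t < \<bar>\<Sum>b\<in>Pow I. walsh S b * c b\<bar> / ?N}"
  have "real (card ?L) * (t * ?N)\<^sup>2 = (\<Sum>S\<in>?L. (t * ?N)\<^sup>2)"
    by simp
  also have "\<dots> \<le> (\<Sum>S\<in>?L. (\<Sum>b\<in>Pow I. walsh S b * c b)\<^sup>2)"
  proof (rule sum_mono)
    fix S assume "S \<in> ?L"
    then have "\<bar>t * ?N\<bar> \<le> \<bar>\<Sum>b\<in>Pow I. walsh S b * c b\<bar>"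
      using assms(3) by (auto simp: field_simps abs_mult)
    then show "(t * ?N)\<^sup>2 \<le> (\<Sum>b\<in>Pow I. walsh S b * c b)\<^sup>2"
      by (simp add: abs_le_square_iff)
  qed
  also have "\<dots> \<le> (\<Sum>S\<in>Pow I. (\<Sum>b\<in>Pow I. walsh S b * c b)\<^sup>2)"
    using assms(1) by (intro sum_mono2) auto
  also have "\<dots> = ?N * (\<Sum>b\<in>Pow I. (c b)\<^sup>2)"
    by (rule walsh_parseval[OF assms(1)])
  also have "\<dots> \<le> ?N * (\<Sum>b\<in>Pow I. 1)"
    using assms(2) by (intro mult_left_mono sum_mono) (auto simp: abs_square_le_1)
  also have "\<dots> = ?N\<^sup>2"
    using assms(1) by (simp add: card_Pow power2_eq_square)
  finally have "real (card ?L) * t\<^sup>2 * ?N\<^sup>2 \<le> 1 * ?N\<^sup>2"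
    by (simp add: power_mult_distrib mult_ac)
  then have "real (card ?L) * t\<^sup>2 \<le> 1"
    by (rule mult_right_le_imp_le) simp
  then show ?thesis
    using assms(3) by (simp add: field_simps)
qed

section \<open>Finitely supported distributions\<close>

lemma space_euclid_iff: "x \<in> space (euclid d) \<longleftrightarrow> x \<in> extensional {..<d}"
  by (auto simp: euclid_def space_PiM PiE_def)

lemma singleton_in_sets_euclid:
  assumes "x \<in> space (euclid d)"
  shows "{x} \<in> sets (euclid d)"
proof -
  have "{x} = (\<Pi>\<^sub>E i\<in>{..<d}. {x i})"
    using assms by (subst PiE_singleton) (auto simp: space_euclid_iff)
  then show ?thesis
    by (simp add: euclid_def)
qed

lemma finite_in_sets_euclid:
  assumes "finite T" "T \<subseteq> space (euclid d)"
  shows "T \<in> sets (euclid d)"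
proof -
  have "(\<Union>x\<in>T. {x}) \<in> sets (euclid d)"
    using assms by (intro sets.finite_UN singleton_in_sets_euclid) auto
  then show ?thesis
    by simp
qed

text \<open>Any \<open>g\<close> agrees almost everywhere with a finite combination of indicators of
  singletons, which are Borel, so it is measurable for the completion. This lets the robust loss of
  an arbitrary classifier be integrated.\<close>

lemma
  fixes g :: "vec \<Rightarrow> real"
  assumes B: "finite B" "B \<noteq> {}" and \<phi>: "\<And>b. \<phi> b \<in> space (euclid d)"
  defines "D \<equiv> distr (measure_pmf (pmf_of_set B)) (euclid d) \<phi>"
  shows integrable_completion_finite_support: "integrable (completion D) g"
    and integral_completion_finite_support:
      "(\<integral>x. g x \<partial>completion D) = (\<Sum>b\<in>B. g (\<phi> b)) / card B"
proof -
  have [measurable]: "\<phi> \<in> measure_pmf (pmf_of_set B) \<rightarrow>\<^sub>M euclid d"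
    using \<phi> by auto
  have [simp]: "sets D = sets (euclid d)" "space D = space (euclid d)"
    by (simp_all add: D_def)
  define g' where "g' = (\<lambda>x. \<Sum>t\<in>\<phi> ` B. g t * indicator {t} x)"
  have T: "{t} \<in> sets D" if "t \<in> \<phi> ` B" for t
    using that \<phi> by (auto intro: singleton_in_sets_euclid)
  have g': "g' \<in> borel_measurable D"
    unfolding g'_def using T
    by (intro borel_measurable_sum borel_measurable_times borel_measurable_indicator) auto
  have g'_eq: "g' x = g x" if "x \<in> \<phi> ` B" for x
  proof -
    have "g' x = (\<Sum>t\<in>\<phi> ` B. if t = x then g t else 0)"
      unfolding g'_def by (intro sum.cong) (auto simp: indicator_def)
    also have "\<dots> = g x"
      using that B(1) by simp
    finally show ?thesis .
  qed
  have "AE x in D. x \<in> \<phi> ` B"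
  proof -
    have "\<phi> ` B \<in> sets (euclid d)"
      using B \<phi> by (intro finite_in_sets_euclid) auto
    then have "{x \<in> space (euclid d). x \<in> \<phi> ` B} \<in> sets (euclid d)"
      by simp
    then show ?thesis
      unfolding D_def using B by (subst AE_distr_iff) (auto simp: AE_measure_pmf_iff \<phi>)
  qed
  then have "AE x in D. g' x = g x"
    by (rule eventually_mono) (rule g'_eq)
  then have AE: "AE x in completion D. g' x = g x"
    by (rule AE_completion)
  have g'_c: "g' \<in> borel_measurable (completion D)"
    using g' by (rule measurable_completion)
  have g_c: "g \<in> borel_measurable (completion D)"
  proof (rule measurableI)
    fix A :: "real set" assume "A \<in> sets borel"
    then have "g' -` A \<inter> space (completion D) \<in> sets (completion D)"
      using g'_c by (rule measurable_sets[rotated])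
    moreover have "AE x in completion D.
        x \<in> g' -` A \<inter> space (completion D) \<longleftrightarrow> x \<in> g -` A \<inter> space (completion D)"
      using AE by (rule eventually_mono) simp
    ultimately show "g -` A \<inter> space (completion D) \<in> sets (completion D)"
      using completion.in_sets_AE by blast
  qed simp
  have int: "integrable D g'"
    unfolding D_def using \<phi> B g'[unfolded D_def]
    by (subst integrable_distr_eq) (simp_all add: integrable_measure_pmf_finite)
  then have "integrable (completion D) g'"
    using g' by (simp add: integrable_completion)
  then show "integrable (completion D) g"
    using g'_c g_c AE integrable_cong_AE by blast
  have "(\<integral>x. g x \<partial>completion D) = (\<integral>x. g' x \<partial>completion D)"
    using g_c g'_c by (rule integral_cong_AE) (use AE in \<open>auto elim: eventually_mono\<close>)
  also have "\<dots> = (\<integral>x. g' x \<partial>D)"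
    using g' by (rule integral_completion)
  also have "\<dots> = (\<integral>b. g' (\<phi> b) \<partial>measure_pmf (pmf_of_set B))"
    using g' \<phi> unfolding D_def by (subst integral_distr) auto
  also have "\<dots> = (\<Sum>b\<in>B. g (\<phi> b)) / card B"
    using B by (subst integral_pmf_of_set) (auto simp: g'_eq)
  finally show "(\<integral>x. g x \<partial>completion D) = (\<Sum>b\<in>B. g (\<phi> b)) / card B" .
qed

lemma prob_space_coin_space: "prob_space coin_space"
  unfolding coin_space_def by (intro prob_space_PiM measure_pmf.prob_space_axioms)

lemma prob_space_sample_space:
  assumes "\<And>i. prob_space (D i)"
  shows "prob_space (sample_space D n)"
  unfolding sample_space_def using assms by (intro prob_space_PiM) auto

lemma holds_with_prob_always:
  assumes "prob_space M" "p \<le> 1" "\<And>\<omega>. \<omega> \<in> space M \<Longrightarrow> P \<omega>"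
  shows "holds_with_prob M p P"
  unfolding holds_with_prob_def
  using assms prob_space.prob_space[OF assms(1)] by (intro bexI[of _ "space M"]) auto

section \<open>The hidden parity family\<close>

locale hidden_parity =
  fixes d m :: nat and R \<rho> :: real
  assumes dim: "m + 2 \<le> d" and R_pos: "0 < R" and \<rho>_pos: "0 < \<rho>"
begin

abbreviation bits :: "nat set set" where
  "bits \<equiv> Pow {0<..m}"

text \<open>The last bit \<open>y\<close> is a free argument, so that the null model and both values
  of the parity coordinate at one \<open>b\<close> can be expressed. Coordinates beyond
  \<open>Suc m\<close> are zero padding.\<close>

definition point :: "bool \<Rightarrow> nat set \<Rightarrow> bool \<Rightarrow> vec" where
  "point i b y = (\<lambda>j\<in>{..<d}.
     if j = 0 then (if i then \<rho> / 2 else - \<rho> / 2)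
     else if j \<le> m then (if j \<in> b then R else - R)
     else if j = Suc m then (if y then R else - R)
     else 0)"

text \<open>Label \<open>True\<close> sets the last bit to the parity of
  \<open>S \<inter> b\<close>, label \<open>False\<close> to its negation; the label is thus the
  agreement of the two.\<close>

definition sample_point :: "nat set \<Rightarrow> bool \<Rightarrow> nat set \<Rightarrow> vec" where
  "sample_point S i b = point i b (odd (card (S \<inter> b)) = i)"

definition parity_pair :: "nat set \<Rightarrow> dist_pair" where
  "parity_pair S i = distr (measure_pmf (pmf_of_set bits)) (euclid d) (sample_point S i)"

lemma point_in_space: "point i b y \<in> space (euclid d)"
  by (simp add: point_def space_euclid_iff)

lemma sample_point_in_space: "sample_point S i b \<in> space (euclid d)"
  by (simp add: sample_point_def point_in_space)

lemma measurable_sample_point: "sample_point S i \<in> measure_pmf p \<rightarrow>\<^sub>M euclid d"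
  using sample_point_in_space by auto

lemma finite_bits: "finite bits" and bits_nonempty: "bits \<noteq> {}" and card_bits: "card bits = 2 ^ m"
  by (auto simp: card_Pow)

lemma sets_parity_pair [simp]: "sets (parity_pair S i) = sets (euclid d)"
  and space_parity_pair [simp]: "space (parity_pair S i) = space (euclid d)"
  by (simp_all add: parity_pair_def)

lemma prob_space_parity_pair: "prob_space (parity_pair S i)"
  unfolding parity_pair_def by (rule measure_pmf.prob_space_distr[OF measurable_sample_point])

lemma is_dist_pair_parity_pair: "is_dist_pair d (parity_pair S)"
  by (simp add: is_dist_pair_def prob_space_parity_pair)

section \<open>Expectations under a parity pair as finite averages\<close>

lemma measure_parity_pair:
  assumes "A \<in> sets (euclid d)"
  shows "measure (parity_pair S i) A = card {b \<in> bits. sample_point S i b \<in> A} / 2 ^ m"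
proof -
  have "measure (parity_pair S i) A = card (bits \<inter> (sample_point S i -` A)) / card bits"
    unfolding parity_pair_def
    by (subst measure_distr[OF measurable_sample_point assms])
       (simp add: measure_pmf_of_set[OF bits_nonempty finite_bits] del: Pow_iff)
  also have "bits \<inter> (sample_point S i -` A) = {b \<in> bits. sample_point S i b \<in> A}"
    by auto
  finally show ?thesis
    by (simp add: card_bits)
qed

lemma integral_parity_pair:
  fixes h :: query
  assumes "h \<in> borel_measurable (euclid d)"
  shows "(\<integral>x. h x \<partial>parity_pair S i) = (\<Sum>b\<in>bits. h (sample_point S i b)) / 2 ^ m"
  unfolding parity_pair_def
  by (subst integral_distr[OF measurable_sample_point])
     (simp_all add: assms integral_pmf_of_set[OF bits_nonempty finite_bits] card_bits)

text \<open>Finite support makes the integrability conjunct automatic, whatever the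
  classifier.\<close>

lemma is_robust_parity_pair_iff:
  "is_robust d \<epsilon> \<delta> (parity_pair S) f \<longleftrightarrow>
     (\<forall>i. (\<Sum>b\<in>bits. robust_loss d \<epsilon> f (sample_point S i b) i) / 2 ^ m \<le> \<delta>)"
proof -
  have integrable: "integrable (completion (parity_pair S i)) g" for i and g :: "vec \<Rightarrow> real"
    unfolding parity_pair_def
    by (rule integrable_completion_finite_support[OF finite_bits bits_nonempty sample_point_in_space])
  have integral: "(\<integral>x. g x \<partial>completion (parity_pair S i)) = (\<Sum>b\<in>bits. g (sample_point S i b)) / 2 ^ m"
    for i and g :: "vec \<Rightarrow> real"
    unfolding parity_pair_def
    by (subst integral_completion_finite_support[OF finite_bits bits_nonempty sample_point_in_space])
       (simp add: card_bits)
  show ?thesis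
    unfolding is_robust_def integral by (simp only: integrable simp_thms)
qed

lemma is_robust_zero_lossI:
  assumes "\<And>i b z. \<lbrakk>b \<subseteq> {0<..m}; z \<in> centered_ball d \<epsilon>\<rbrakk> \<Longrightarrow> f (vadd d (sample_point S i b) z) = i"
    and "0 \<le> \<delta>"
  shows "is_robust d \<epsilon> \<delta> (parity_pair S) f"
proof -
  have "robust_loss d \<epsilon> f (sample_point S i b) i = 0" if "b \<in> bits" for i b
    using that assms(1) by (auto simp: robust_loss_def)
  then show ?thesis
    using assms(2) by (simp add: is_robust_parity_pair_iff)
qed

section \<open>Robust decoding, linear separation and norm bound\<close>

lemma abs_le_of_centered_ball:
  assumes "z \<in> centered_ball d \<epsilon>" "j < d"
  shows "\<bar>z j\<bar> \<le> \<epsilon>"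
proof -
  have "\<bar>z j\<bar> \<le> L2_set (\<lambda>j. \<bar>z j\<bar>) {..<d}"
    using assms by (intro member_le_L2_set) auto
  also have "\<dots> = L2_set z {..<d}"
    by (simp add: L2_set_def)
  finally show ?thesis
    using assms by (simp add: centered_ball_def)
qed

definition parity_classifier :: "nat set \<Rightarrow> classifier" where
  "parity_classifier S x \<longleftrightarrow> (odd (card (S \<inter> {j \<in> {0<..m}. 0 < x j})) \<longleftrightarrow> 0 < x (Suc m))"

text \<open>A perturbation of norm below \<open>R\<close> moves each coordinate by less than
  \<open>R\<close>, so no sign of a bit or of the parity coordinate flips and decoding is
  exact.\<close>

lemma robust_parity_classifier:
  assumes "\<epsilon> < R" "0 \<le> \<delta>"
  shows "is_robust d \<epsilon> \<delta> (parity_pair S) (parity_classifier S)"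
proof (rule is_robust_zero_lossI[OF _ assms(2)])
  fix i b z assume b: "b \<subseteq> {0<..m}" and z: "z \<in> centered_ball d \<epsilon>"
  let ?x = "vadd d (sample_point S i b) z"
  have z_lt: "\<bar>z j\<bar> < R" if "j \<le> Suc m" for j
    using abs_le_of_centered_ball[OF z, of j] that dim assms(1) by simp
  have "0 < ?x j \<longleftrightarrow> j \<in> b" if "j \<in> {0<..m}" for j
    using that dim z_lt[of j] by (auto simp: vadd_def sample_point_def point_def abs_less_iff)
  then have "{j \<in> {0<..m}. 0 < ?x j} = b"
    using b by blast
  moreover have "0 < ?x (Suc m) \<longleftrightarrow> (odd (card (S \<inter> b)) = i)"
    using dim z_lt[of "Suc m"] by (auto simp: vadd_def sample_point_def point_def abs_less_iff)
  ultimately show "parity_classifier S ?x = i"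
    unfolding parity_classifier_def by auto
qed

lemma separates_parity_pair:
  assumes "w 0 = 1" "\<And>j. \<lbrakk>0 < j; j < d\<rbrakk> \<Longrightarrow> w j = 0"
  shows "separates d (parity_pair S) (linear_classifier d w 0)"
  unfolding separates_def
proof (rule is_robust_zero_lossI)
  fix i b z assume z: "z \<in> centered_ball d 0"
  let ?x = "vadd d (sample_point S i b) z"
  have "(\<Sum>j<d. w j * ?x j) = (\<Sum>j\<in>{0}. w j * ?x j)"
    using dim assms(2) by (intro sum.mono_neutral_right) auto
  also have "\<dots> = (if i then \<rho> / 2 else - \<rho> / 2)"
    using dim abs_le_of_centered_ball[OF z, of 0] assms(1)
    by (simp add: vadd_def sample_point_def point_def)
  finally show "linear_classifier d w 0 ?x = i"
    using \<rho>_pos by (simp add: linear_classifier_def)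
qed simp

lemma L2_set_sample_point_le:
  assumes "real m * R\<^sup>2 + R\<^sup>2 + \<rho>\<^sup>2 \<le> r\<^sup>2" "0 \<le> r"
  shows "L2_set (sample_point S i b) {..<d} \<le> r"
proof -
  let ?x = "sample_point S i b"
  have "(\<Sum>j<d. (?x j)\<^sup>2) = (\<Sum>j\<in>{0} \<union> {1..Suc m}. (?x j)\<^sup>2)"
    using dim by (intro sum.mono_neutral_right) (auto simp: sample_point_def point_def)
  also have "\<dots> = (?x 0)\<^sup>2 + (\<Sum>j\<in>{1..Suc m}. (?x j)\<^sup>2)"
    by (subst sum.union_disjoint) auto
  also have "(?x 0)\<^sup>2 \<le> \<rho>\<^sup>2"
    using dim by (auto simp: sample_point_def point_def power_divide)
  also have "(\<Sum>j\<in>{1..Suc m}. (?x j)\<^sup>2) = (\<Sum>j\<in>{1..Suc m}. R\<^sup>2)"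
    using dim by (intro sum.cong refl) (auto simp: sample_point_def point_def)
  finally have "(\<Sum>j<d. (?x j)\<^sup>2) \<le> r\<^sup>2"
    using assms(1) by (simp add: algebra_simps)
  then show ?thesis
    using assms(2) by (simp add: L2_set_def real_le_lsqrt)
qed

subsection \<open>Statistical query hardness\<close>

text \<open>What a query would return if the parity coordinate were an unbiased coin.\<close>

definition null_answer :: "query \<Rightarrow> response" where
  "null_answer h i = (\<Sum>b\<in>bits. (h (point i b True) + h (point i b False)) / 2) / 2 ^ m"

text \<open>At each string the sampled value is the mean over both last bits, plus or minus half
  their difference. That sign is \<open>walsh S b\<close> up to a sign depending on the label, which
  the absolute value removes.\<close>

lemma deviation_from_null_answer:
  assumes "h \<in> borel_measurable (euclid d)"
  shows "\<bar>null_answer h i - (\<integral>x. h x \<partial>parity_pair S i)\<bar> =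
    \<bar>\<Sum>b\<in>bits. walsh S b * ((h (point i b True) - h (point i b False)) / 2)\<bar> / 2 ^ m"
proof -
  let ?s = "if i then 1 else - 1 :: real"
  have "h (sample_point S i b) = (h (point i b True) + h (point i b False)) / 2
      - ?s * (walsh S b * ((h (point i b True) - h (point i b False)) / 2))" for b
    by (auto simp: sample_point_def walsh_eq_if field_simps)
  then have "null_answer h i - (\<integral>x. h x \<partial>parity_pair S i)
      = ?s * ((\<Sum>b\<in>bits. walsh S b * ((h (point i b True) - h (point i b False)) / 2)) / 2 ^ m)"
    unfolding integral_parity_pair[OF assms] null_answer_def
    by (simp only: sum_subtractf diff_divide_distrib sum_distrib_left[symmetric]) simp
  then show ?thesis
    by (simp add: abs_mult)
qed

text \<open>The half-differences of a query are bounded by 1, so at most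
  \<open>1 / \<tau>\<^sup>2\<close> coefficients are large per label; the factor 2 pays for the two
  labels.\<close>

lemma card_detecting_parities:
  assumes h: "is_query d h" and "0 < \<tau>"
  shows "real (card {S \<in> bits. \<exists>i. \<tau> < \<bar>null_answer h i - (\<integral>x. h x \<partial>parity_pair S i)\<bar>}) \<le> 2 / \<tau>\<^sup>2"
proof -
  let ?K = "\<lambda>i. {S \<in> bits. \<tau> < \<bar>null_answer h i - (\<integral>x. h x \<partial>parity_pair S i)\<bar>}"
  have h01: "0 \<le> h (point i b y)" "h (point i b y) \<le> 1" for i b y
    using h point_in_space by (auto simp: is_query_def)
  have K: "real (card (?K i)) \<le> 1 / \<tau>\<^sup>2" for i
  proof -
    have "\<bar>(h (point i b True) - h (point i b False)) / 2\<bar> \<le> 1" for b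
      using h01[of i b True] h01[of i b False] by auto
    from card_large_walsh_coefficients[of "{0<..m}", OF _ this \<open>0 < \<tau>\<close>] show ?thesis
      using h by (simp add: deviation_from_null_answer is_query_def)
  qed
  have "card {S \<in> bits. \<exists>i. \<tau> < \<bar>null_answer h i - (\<integral>x. h x \<partial>parity_pair S i)\<bar>}
      \<le> card (?K True \<union> ?K False)"
    using finite_bits by (intro card_mono) (auto simp: ex_bool_eq)
  also have "\<dots> \<le> card (?K True) + card (?K False)"
    by (rule card_Un_le)
  finally show ?thesis
    using K[of True] K[of False] by linarith
qed

text \<open>
  Since \<open>\<epsilon> \<ge> \<rho>\<close>, a negative sample can be moved to the positive value of coordinate 0.  Hence
  \<open>b \<mapsto> f (point True b True) - f (point True b False)\<close> nearly equals \<open>- walsh S\<close>.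
\<close>

lemma robust_imp_large_walsh_coefficient:
  assumes "\<rho> \<le> \<epsilon>" "is_robust d \<epsilon> 0.01 (parity_pair S) f"
  shows "9/10 < \<bar>\<Sum>b\<in>bits. walsh S b * (of_bool (f (point True b True)) - of_bool (f (point True b False)))\<bar> / 2 ^ m"
proof -
  let ?c = "\<lambda>b. of_bool (f (point True b True)) - of_bool (f (point True b False)) :: real"
  let ?l = "\<lambda>i b. robust_loss d \<epsilon> f (sample_point S i b) i"
  \<comment> \<open>The shift raises the label coordinate of a negative sample from
    \<open>- \<rho> / 2\<close> to \<open>\<rho> / 2\<close> and leaves positive samples
    alone.\<close>
  define z where "z i = (\<lambda>j\<in>{..<d}. if j = 0 \<and> \<not> i then \<rho> else 0)" for i :: bool
  have z: "z i \<in> centered_ball d \<epsilon>" for i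
  proof -
    have "(\<Sum>j<d. (z i j)\<^sup>2) = (\<Sum>j<d. if j = 0 then (if i then 0 else \<rho>\<^sup>2) else 0)"
      by (intro sum.cong) (auto simp: z_def)
    then have "L2_set (z i) {..<d} = (if i then 0 else \<rho>)"
      using dim \<rho>_pos by (simp add: L2_set_def)
    then show ?thesis
      using assms(1) \<rho>_pos by (auto simp: centered_ball_def z_def space_euclid_iff)
  qed
  have shift: "vadd d (sample_point S i b) (z i) = point True b (odd (card (S \<inter> b)) = i)" for i b
    using dim by (auto simp: vadd_def z_def sample_point_def point_def fun_eq_iff)
  have loss: "of_bool (f (point True b (odd (card (S \<inter> b)) = i)) \<noteq> i) \<le> ?l i b" for i b
    using z[of i] shift[of i b] by (force simp: robust_loss_def)
  \<comment> \<open>Without loss at \<open>b\<close> the difference \<open>?c b\<close> equals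
    \<open>- walsh S b\<close>; with one loss the left side is still at least 0, with two at least
    -1.\<close>
  have "- (walsh S b * ?c b) \<ge> 1 - ?l True b - ?l False b" for b
    using loss[of b True] loss[of b False]
    by (cases "odd (card (S \<inter> b))"; cases "f (point True b True)"; cases "f (point True b False)")
       (auto simp: walsh_eq_if)
  then have "(\<Sum>b\<in>bits. - (walsh S b * ?c b)) \<ge> (\<Sum>b\<in>bits. 1 - ?l True b - ?l False b)"
    by (rule sum_mono)
  then have "- (\<Sum>b\<in>bits. walsh S b * ?c b) \<ge> 2 ^ m - (\<Sum>b\<in>bits. ?l True b) - (\<Sum>b\<in>bits. ?l False b)"
    by (simp add: sum_subtractf sum_negf card_bits)
  moreover have "(\<Sum>b\<in>bits. ?l i b) \<le> 1/100 * 2 ^ m" for i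
    using assms(2) by (auto simp: is_robust_parity_pair_iff field_simps)
  \<comment> \<open>The two losses together take at most 1/50, so the normalised correlation is at
    least 49/50, above 9/10.\<close>
  from this[of True] this[of False]
  have "(\<Sum>b\<in>bits. ?l True b) + (\<Sum>b\<in>bits. ?l False b) \<le> 1/50 * 2 ^ m"
    by linarith
  moreover have "(0::real) < 2 ^ m"
    by simp
  ultimately have "9/10 * 2 ^ m < \<bar>\<Sum>b\<in>bits. walsh S b * ?c b\<bar>"
    by linarith
  then show ?thesis
    by (simp add: field_simps)
qed

text \<open>Robustness for \<open>S\<close> forces a Walsh coefficient above 9/10 at
  \<open>S\<close> of a function depending on \<open>f\<close> alone. Parseval allows at most
  \<open>1 / (9/10)^2 < 2\<close> such sets.\<close>

lemma card_robust_parities: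
  assumes "\<rho> \<le> \<epsilon>"
  shows "card {S \<in> bits. is_robust d \<epsilon> 0.01 (parity_pair S) f} \<le> 1"
proof -
  let ?c = "\<lambda>b. of_bool (f (point True b True)) - of_bool (f (point True b False)) :: real"
  let ?L = "{S \<in> bits. 9/10 < \<bar>\<Sum>b\<in>bits. walsh S b * ?c b\<bar> / 2 ^ card {0<..m}}"
  have "card {S \<in> bits. is_robust d \<epsilon> 0.01 (parity_pair S) f} \<le> card ?L"
    using finite_bits robust_imp_large_walsh_coefficient[OF assms] by (intro card_mono) auto
  moreover have "real (card ?L) \<le> 1 / (9/10)\<^sup>2"
    by (rule card_large_walsh_coefficients) auto
  then have "real (card ?L) < 2"
    by (rule order.strict_trans1) (simp add: power2_eq_square)
  ultimately show ?thesis
    by linarith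
qed

text \<open>The null answer carries no information about \<open>S\<close>, so it is given whenever
  it is valid for both labels; otherwise the exact expectations are.\<close>

definition parity_oracle :: "real \<Rightarrow> nat set \<Rightarrow> oracle_strategy" where
  "parity_oracle \<tau> S hs =
     (if \<exists>i. \<tau> < \<bar>null_answer (hd hs) i - (\<integral>x. hd hs x \<partial>parity_pair S i)\<bar>
      then (\<lambda>i. \<integral>x. hd hs x \<partial>parity_pair S i) else null_answer (hd hs))"

lemma valid_parity_oracle: "0 < \<tau> \<Longrightarrow> valid_oracle d \<tau> (parity_pair S) (parity_oracle \<tau> S)"
  by (auto simp: valid_oracle_def parity_oracle_def not_less)

text \<open>Along the branch of null answers all undetected sets see the same tree. Each query
  removes at most \<open>2 / \<tau>\<^sup>2\<close> of them, and the classifier at the leaf serves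
  at most one survivor. The induction shrinks \<open>W\<close> to the survivors.\<close>

lemma card_learned_parities:
  assumes "0 < \<tau>" "\<rho> \<le> \<epsilon>" "sq_tree_valid d t" "W \<subseteq> bits"
    and "\<And>S. S \<in> W \<Longrightarrow> sq_count (parity_oracle \<tau> S) hs t \<le> n"
  shows "real (card {S \<in> W. is_robust d \<epsilon> 0.01 (parity_pair S) (sq_run (parity_oracle \<tau> S) hs t)})
    \<le> n * (2 / \<tau>\<^sup>2) + 1"
  using assms(3-)
proof (induction t arbitrary: hs n W)
  case (Output f)
  have "card {S \<in> W. is_robust d \<epsilon> 0.01 (parity_pair S) f}
      \<le> card {S \<in> bits. is_robust d \<epsilon> 0.01 (parity_pair S) f}"
    using Output(2) finite_bits by (intro card_mono) auto
  also have "\<dots> \<le> 1"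
    by (rule card_robust_parities[OF assms(2)])
  finally have "real (card {S \<in> W. is_robust d \<epsilon> 0.01 (parity_pair S) f}) \<le> 1"
    by simp
  also have "\<dots> \<le> n * (2 / \<tau>\<^sup>2) + 1"
    by simp
  finally show ?case
    by simp
next
  case (Ask h k)
  show ?case
  proof (cases "W = {}")
    case False
    \<comment> \<open>Any member of \<open>W\<close> has a run that asks \<open>h\<close>, so the
      budget \<open>n\<close> is positive.\<close>
    then obtain n' where n: "n = Suc n'"
      using Ask.prems(3) by (cases n) force+
    let ?G = "{S \<in> W. is_robust d \<epsilon> 0.01 (parity_pair S) (sq_run (parity_oracle \<tau> S) hs (Ask h k))}"
    let ?K = "{S \<in> bits. \<exists>i. \<tau> < \<bar>null_answer h i - (\<integral>x. h x \<partial>parity_pair S i)\<bar>}"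
    have null: "parity_oracle \<tau> S (h # hs) = null_answer h" if "S \<in> W - ?K" for S
      using that Ask.prems(2) by (auto simp: parity_oracle_def)
    let ?G' = "{S \<in> W - ?K. is_robust d \<epsilon> 0.01 (parity_pair S)
        (sq_run (parity_oracle \<tau> S) (h # hs) (k (null_answer h)))}"
    \<comment> \<open>Undetected sets all continue in the subtree \<open>k (null_answer h)\<close>,
      so one instance of the induction hypothesis covers them; detected sets are all conceded as
      learned.\<close>
    have "real (card ?G') \<le> n' * (2 / \<tau>\<^sup>2) + 1"
    proof (rule Ask.IH)
      fix S assume S: "S \<in> W - ?K"
      then show "sq_count (parity_oracle \<tau> S) (h # hs) (k (null_answer h)) \<le> n'"
        using Ask.prems(3)[of S] null[OF S] n by simp
    qed (use Ask.prems in auto)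
    moreover have "?G \<subseteq> ?G' \<union> ?K"
      using Ask.prems(2) null by auto
    then have "card ?G \<le> card (?G' \<union> ?K)"
      using finite_bits Ask.prems(2) by (intro card_mono) (auto intro: finite_subset)
    then have "card ?G \<le> card ?G' + card ?K"
      using card_Un_le[of ?G' ?K] by linarith
    moreover have "real (card ?K) \<le> 2 / \<tau>\<^sup>2"
      using Ask.prems(1) assms(1) by (intro card_detecting_parities) auto
    ultimately have "real (card ?G) \<le> n' * (2 / \<tau>\<^sup>2) + 1 + 2 / \<tau>\<^sup>2"
      by linarith
    also have "\<dots> = n * (2 / \<tau>\<^sup>2) + 1"
      by (simp add: n algebra_simps add_divide_distrib)
    finally show ?thesis .
  qed simp
qed

text \<open>Averaging over the coins: each set is learned with probability at least 2/3, while for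
  fixed coins only few sets are learned. Exchanging sum and integral compares the two
  counts.\<close>

lemma sq_query_lower_bound:
  assumes "0 < \<tau>" "\<rho> \<le> \<epsilon>" "\<And>\<omega>. sq_tree_valid d (A \<omega>)"
    and learns: "sq_learns d \<tau> \<epsilon> 0.01 (parity_pair ` bits) A"
    and few: "\<not> sq_makes_at_least d \<tau> (parity_pair ` bits) A N"
  shows "2 / 3 * 2 ^ m \<le> real (nat \<lceil>N\<rceil>) * (2 / \<tau>\<^sup>2) + 1"
proof -
  let ?run = "\<lambda>S \<omega>. sq_run (parity_oracle \<tau> S) [] (A \<omega>)"
  let ?bound = "real (nat \<lceil>N\<rceil>) * (2 / \<tau>\<^sup>2) + 1"
  interpret coin: prob_space coin_space
    by (rule prob_space_coin_space)
  have "\<forall>S\<in>bits. \<exists>E\<in>sets coin_space. 2 / 3 \<le> measure coin_space E \<and>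
      (\<forall>\<omega>\<in>E. is_robust d \<epsilon> 0.01 (parity_pair S) (?run S \<omega>))"
    using learns valid_parity_oracle[OF assms(1)]
    unfolding sq_learns_def holds_with_prob_def by blast
  \<comment> \<open>Success itself need not be a measurable event, so a measurable event inside it
    is fixed for each set.\<close>
  then obtain E where E: "\<And>S. S \<in> bits \<Longrightarrow> E S \<in> sets coin_space"
      "\<And>S. S \<in> bits \<Longrightarrow> 2 / 3 \<le> measure coin_space (E S)"
      "\<And>S \<omega>. \<lbrakk>S \<in> bits; \<omega> \<in> E S\<rbrakk> \<Longrightarrow> is_robust d \<epsilon> 0.01 (parity_pair S) (?run S \<omega>)"
    by metis
  have bound: "(\<Sum>S\<in>bits. indicator (E S) \<omega>) \<le> ?bound" for \<omega>
  proof -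
    have "sq_count (parity_oracle \<tau> S) [] (A \<omega>) \<le> nat \<lceil>N\<rceil>" if "S \<in> bits" for S
    proof -
      have "\<not> N \<le> real (sq_count (parity_oracle \<tau> S) [] (A \<omega>))"
        using few that valid_parity_oracle[OF assms(1)] unfolding sq_makes_at_least_def by blast
      then show ?thesis
        by linarith
    qed
    then have "real (card {S \<in> bits. is_robust d \<epsilon> 0.01 (parity_pair S) (?run S \<omega>)}) \<le> ?bound"
      using assms(1,2,3) by (intro card_learned_parities) auto
    moreover have "card {S \<in> bits. \<omega> \<in> E S}
        \<le> card {S \<in> bits. is_robust d \<epsilon> 0.01 (parity_pair S) (?run S \<omega>)}"
      using E(3) finite_bits by (intro card_mono) auto
    moreover have "(\<Sum>S\<in>bits. indicator (E S) \<omega>) = real (card {S \<in> bits. \<omega> \<in> E S})"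
      using finite_bits by (simp add: indicator_def Int_def flip: of_bool_def)
    ultimately show ?thesis
      by linarith
  qed
  have integrable: "integrable coin_space (indicator (E S) :: coins \<Rightarrow> real)" if "S \<in> bits" for S
    using E(1)[OF that] coin.emeasure_finite by (intro integrable_real_indicator) (auto simp: less_top[symmetric])
  have "2 / 3 * 2 ^ m = (\<Sum>S\<in>bits. 2 / 3 :: real)"
    by (simp add: card_bits)
  also have "\<dots> \<le> (\<Sum>S\<in>bits. measure coin_space (E S))"
    by (rule sum_mono) (rule E(2))
  also have "\<dots> = (\<integral>\<omega>. (\<Sum>S\<in>bits. indicator (E S) \<omega>) \<partial>coin_space)"
    using E(1) by (subst Bochner_Integration.integral_sum[OF integrable]) auto
  also have "\<dots> \<le> (\<integral>\<omega>. ?bound \<partial>coin_space)"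
    using bound by (intro integral_mono Bochner_Integration.integrable_sum integrable) auto
  also have "\<dots> = ?bound"
    by (simp add: coin.prob_space)
  finally show ?thesis .
qed

subsection \<open>Learning from samples\<close>

text \<open>The finite support of the label-\<open>False\<close> distribution; a candidate set is
  tested by membership of the samples in it.\<close>

definition negative_support :: "nat set \<Rightarrow> vec set" where
  "negative_support S = sample_point S False ` bits"

lemma negative_support_in_sets: "negative_support S \<in> sets (euclid d)"
  unfolding negative_support_def using finite_bits sample_point_in_space
  by (intro finite_in_sets_euclid) auto

text \<open>As \<open>R\<close> is positive, a point determines its string and its last bit, so
  membership compares the two parities at the same \<open>b\<close>.\<close>

lemma sample_point_in_negative_support_iff:
  assumes "b \<in> bits"
  shows "sample_point S False b \<in> negative_support T \<longleftrightarrow> odd (card (S \<inter> b)) = odd (card (T \<inter> b))"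
proof
  assume "sample_point S False b \<in> negative_support T"
  then obtain b' where b': "b' \<in> bits" and eq: "sample_point S False b = sample_point T False b'"
    by (auto simp: negative_support_def)
  have "j \<in> b \<longleftrightarrow> j \<in> b'" if "j \<in> {0<..m}" for j
    using fun_cong[OF eq, of j] that dim R_pos by (auto simp: sample_point_def point_def split: if_splits)
  then have "b = b'"
    using assms b' by blast
  then show "odd (card (S \<inter> b)) = odd (card (T \<inter> b))"
    using fun_cong[OF eq, of "Suc m"] dim R_pos by (auto simp: sample_point_def point_def split: if_splits)
qed (use assms in \<open>auto simp: negative_support_def sample_point_def\<close>)

text \<open>The indicator that two parities agree is \<open>(1 + walsh S b * walsh T b) / 2\<close>,
  so by orthogonality a wrong candidate passes half the time.\<close>

lemma measure_negative_support:
  assumes "S \<in> bits" "T \<in> bits"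
  shows "measure (parity_pair S False) (negative_support T) = (if S = T then 1 else 1 / 2)"
proof -
  have "real (card {b \<in> bits. sample_point S False b \<in> negative_support T})
      = (\<Sum>b\<in>bits. of_bool (odd (card (S \<inter> b)) = odd (card (T \<inter> b))))"
    using finite_bits by (simp add: sample_point_in_negative_support_iff Int_def cong: conj_cong)
  also have "\<dots> = (\<Sum>b\<in>bits. (1 + walsh S b * walsh T b) / 2)"
    by (intro sum.cong) (auto simp: walsh_eq_if)
  also have "\<dots> = (2 ^ m + (\<Sum>b\<in>bits. walsh S b * walsh T b)) / 2"
    by (simp add: sum.distrib card_bits flip: sum_divide_distrib)
  also have "(\<Sum>b\<in>bits. walsh S b * walsh T b) = (if S = T then 2 ^ m else 0)"
    using assms by (subst sum_Pow_walsh_prod) auto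
  finally have card: "real (card {b \<in> bits. sample_point S False b \<in> negative_support T})
      = (if S = T then 2 ^ m else 2 ^ m / 2)"
    by (simp split: if_splits)
  show ?thesis
    unfolding measure_parity_pair[OF negative_support_in_sets] card by simp
qed

text \<open>Positive samples are left unconstrained. As a product set the event has a probability
  that factors over the samples.\<close>

definition consistent_samples :: "nat \<Rightarrow> nat set \<Rightarrow> samples set" where
  "consistent_samples n T =
     (\<Pi>\<^sub>E (i, j)\<in>UNIV \<times> {..<n}. if i then space (euclid d) else negative_support T)"

lemma mem_consistent_samples_iff:
  "s \<in> consistent_samples n T \<longleftrightarrow> s \<in> extensional (UNIV \<times> {..<n}) \<and>
     (\<forall>j<n. s (True, j) \<in> space (euclid d) \<and> s (False, j) \<in> negative_support T)"
proof -
  have all: "(\<forall>p\<in>UNIV \<times> {..<n}. P p) \<longleftrightarrow> (\<forall>j<n. P (True, j) \<and> P (False, j))" for P :: "bool \<times> nat \<Rightarrow> bool"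
    by (auto simp: all_bool_eq)
  then show ?thesis
    unfolding consistent_samples_def PiE_iff all by auto
qed

lemma consistent_samples_in_sets: "consistent_samples n T \<in> sets (sample_space (parity_pair S) n)"
  unfolding consistent_samples_def sample_space_def
  using negative_support_in_sets by (intro sets_PiM_I_finite) auto

lemma measure_consistent_samples:
  assumes "S \<in> bits" "T \<in> bits"
  shows "measure (sample_space (parity_pair S) n) (consistent_samples n T) = (if S = T then 1 else (1 / 2) ^ n)"
proof -
  let ?D = "\<lambda>(i, j :: nat). parity_pair S i"
  have product: "finite_product_prob_space ?D (UNIV \<times> {..<n})"
  proof -
    interpret product_prob_space ?D
      by (rule product_prob_spaceI) (simp add: prob_space_parity_pair split: prod.split)
    show ?thesis
      by standard simp
  qed
  let ?X = "\<lambda>(i, j :: nat). if i then space (euclid d) else negative_support T"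
  have one: "measure (parity_pair S True) (space (euclid d)) = 1"
    using prob_space.prob_space[OF prob_space_parity_pair[of S True]] by simp
  have "measure (sample_space (parity_pair S) n) (consistent_samples n T)
      = (\<Prod>p\<in>UNIV \<times> {..<n}. measure (?D p) (?X p))"
    unfolding sample_space_def consistent_samples_def
    using negative_support_in_sets by (intro finite_product_prob_space.prob_times[OF product]) auto
  also have "\<dots> = (\<Prod>i\<in>UNIV. \<Prod>j<n. measure (parity_pair S i) (?X (i, j)))"
    by (subst prod.cartesian_product) (auto intro: prod.cong)
  also have "\<dots> = measure (parity_pair S False) (negative_support T) ^ n"
    by (simp add: UNIV_bool one)
  finally show ?thesis
    by (simp add: measure_negative_support[OF assms])
qed

text \<open>The learner decodes with some candidate consistent with all negative samples. Each wrong
  candidate survives with probability \<open>(1 / 2) ^ n\<close>, and the union bound over at most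
  \<open>2 ^ m\<close> of them gives failure probability at most 1/3.\<close>

lemma robustly_learnable_parities:
  assumes "\<epsilon> < R" "0 \<le> \<delta>" "2 ^ m * (1 / 2) ^ n \<le> (1 / 3 :: real)"
  shows "robustly_learnable d \<epsilon> \<delta> (parity_pair ` bits) n"
proof -
  define learn :: "coins \<Rightarrow> samples \<Rightarrow> classifier" where
    "learn \<omega> s = parity_classifier (SOME T. T \<in> bits \<and> (\<forall>j<n. s (False, j) \<in> negative_support T))" for \<omega> s
  have "holds_with_prob (coin_space \<Otimes>\<^sub>M sample_space (parity_pair S) n) (2 / 3)
      (\<lambda>(\<omega>, s). is_robust d \<epsilon> \<delta> (parity_pair S) (learn \<omega> s))" if S: "S \<in> bits" for S
  proof -
    let ?M = "sample_space (parity_pair S) n"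
    interpret M: prob_space ?M
      by (rule prob_space_sample_space[OF prob_space_parity_pair])
    interpret coin: prob_space coin_space
      by (rule prob_space_coin_space)
    note cons_sets = consistent_samples_in_sets[of n _ S]
    let ?U = "\<Union>T\<in>bits - {S}. consistent_samples n T"
    have U: "?U \<in> sets ?M"
      using finite_bits cons_sets by (intro sets.finite_UN) auto
    \<comment> \<open>On \<open>E\<close> the true set is the only consistent candidate, which
      determines the learner's \<open>SOME\<close>.\<close>
    define E where "E = consistent_samples n S - ?U"
    have E: "E \<in> sets ?M"
      using cons_sets U by (auto simp: E_def)
    have "measure ?M ?U \<le> (\<Sum>T\<in>bits - {S}. measure ?M (consistent_samples n T))"
      using finite_bits cons_sets by (intro M.finite_measure_subadditive_finite) auto
    also have "\<dots> = (\<Sum>T\<in>bits - {S}. (1 / 2) ^ n)"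
      using S by (intro sum.cong) (auto simp: measure_consistent_samples)
    also have "\<dots> \<le> 2 ^ m * (1 / 2) ^ n"
      using card_mono[OF finite_bits, of "bits - {S}"] card_bits
      by (simp add: divide_right_mono power_divide)
    finally have "measure ?M ?U \<le> 1 / 3"
      using assms(3) by linarith
    moreover have "measure ?M (consistent_samples n S \<inter> ?U) \<le> measure ?M ?U"
      using U by (intro M.finite_measure_mono) auto
    moreover have "measure ?M E = measure ?M (consistent_samples n S) - measure ?M (consistent_samples n S \<inter> ?U)"
      unfolding E_def using cons_sets U by (rule M.finite_measure_Diff')
    ultimately have "2 / 3 \<le> measure ?M E"
      using S by (simp add: measure_consistent_samples)
    then have "2 / 3 \<le> measure (coin_space \<Otimes>\<^sub>M ?M) (space coin_space \<times> E)"
      using E by (simp add: measure_def M.emeasure_pair_measure_Times coin.emeasure_space_1)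
    moreover have "is_robust d \<epsilon> \<delta> (parity_pair S) (learn \<omega> s)" if "s \<in> E" for \<omega> s
    proof -
      have iff: "s \<in> consistent_samples n T \<longleftrightarrow> (\<forall>j<n. s (False, j) \<in> negative_support T)" for T
        using that by (auto simp: E_def mem_consistent_samples_iff)
      have "(SOME T. T \<in> bits \<and> (\<forall>j<n. s (False, j) \<in> negative_support T)) = S"
        using that S by (intro some_equality) (auto simp: E_def simp flip: iff)
      then show ?thesis
        using robust_parity_classifier[OF assms(1,2)] by (simp add: learn_def)
    qed
    moreover have "space coin_space \<times> E \<in> sets (coin_space \<Otimes>\<^sub>M ?M)"
      using E by auto
    ultimately show ?thesis
      unfolding holds_with_prob_def by (intro bexI[of _ "space coin_space \<times> E"]) auto
  qed
  then show ?thesis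
    unfolding robustly_learnable_def by (intro exI[of _ learn]) auto
qed

section \<open>Concentration in a ball\<close>

lemma measure_ball_parity_pair:
  assumes "real m * R\<^sup>2 + R\<^sup>2 + \<rho>\<^sup>2 \<le> r\<^sup>2" "0 \<le> r"
  shows "measure (parity_pair S i)
    {x \<in> space (euclid d). L2_set (\<lambda>j. x j - (\<lambda>j\<in>{..<d}. 0) j) {..<d} \<le> r} = 1"
proof -
  have L2: "L2_set (\<lambda>j. x j - (\<lambda>j\<in>{..<d}. 0) j) {..<d} = L2_set x {..<d}" for x :: vec
    by (simp add: L2_set_def)
  have "{x \<in> space (euclid d). L2_set x {..<d} \<le> r} \<in> sets (euclid d)"
    unfolding euclid_def L2_set_def by measurable
  moreover have "{b \<in> bits. sample_point S i b \<in> {x \<in> space (euclid d). L2_set x {..<d} \<le> r}} = bits"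
    using L2_set_sample_point_le[OF assms] sample_point_in_space by auto
  ultimately show ?thesis
    unfolding L2 by (simp only: measure_parity_pair card_bits) simp
qed

end

section \<open>The main theorem\<close>

lemma ram_run_separator:
  assumes "0 < d" "0 < T"
  shows "pc (ram_run [RSet 1 1] d n T \<omega> s) = 1" "mem (ram_run [RSet 1 1] d n T \<omega> s) = (\<lambda>_. 0)(0 := 1)"
proof -
  let ?f = "ram_step [RSet 1 1] \<omega> (sample_input d n s)"
  \<comment> \<open>\<open>RSet 1 1\<close> writes the constant 1 to the cell addressed by index
    register 1. That register starts at 0, since only register 0 holds \<open>d\<close>; so cell 0
    becomes 1 and the program has ended.\<close>
  have step: "?f (ram_init d) = (ram_init d)\<lparr>pc := 1, mem := (\<lambda>_. 0)(0 := 1)\<rparr>"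
    by (simp add: ram_step_def ram_init_def)
  have fixpoint: "(?f ^^ t) (?f (ram_init d)) = ?f (ram_init d)" for t
    unfolding step by (induction t) (simp_all add: ram_step_def)
  obtain t where "T = Suc t"
    using assms(2) by (cases T) auto
  then have "ram_run [RSet 1 1] d n T \<omega> s = (ram_init d)\<lparr>pc := 1, mem := (\<lambda>_. 0)(0 := 1)\<rparr>"
    unfolding ram_run_def by (simp only: funpow_Suc_right o_apply fixpoint[unfolded step] step)
  then show "pc (ram_run [RSet 1 1] d n T \<omega> s) = 1" "mem (ram_run [RSet 1 1] d n T \<omega> s) = (\<lambda>_. 0)(0 := 1)"
    by simp_all
qed

text \<open>With \<open>u = d powr (1/4)\<close>, \<open>2 powr u\<close> queries of precision
  \<open>2 powr - u\<close> detect on the order of \<open>2 powr (3 * u)\<close> sets, fewer than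
  the \<open>2 ^ m\<close> available once \<open>m\<close> is about
  \<open>u\<^sup>2\<close>.\<close>

lemma parity_count_exceeds_sq_bound:
  fixes u \<tau> :: real
  assumes "5 \<le> u" "2 powr - u \<le> \<tau>" "u\<^sup>2 - 1 \<le> real m"
  shows "real (nat \<lceil>2 powr u\<rceil>) * (2 / \<tau>\<^sup>2) + 1 < 2 / 3 * 2 ^ m"
proof -
  have \<tau>: "0 < \<tau>"
    using assms(2) less_le_trans powr_gt_zero by (metis zero_neq_numeral)
  have "(2 powr - u)\<^sup>2 \<le> \<tau>\<^sup>2"
    using assms(2) by (intro power_mono) auto
  then have "2 / \<tau>\<^sup>2 \<le> 2 / (2 powr - u)\<^sup>2"
    using \<tau> by (intro divide_left_mono) auto
  also have "\<dots> = 2 * 2 powr (2 * u)"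
    by (simp add: powr_minus field_simps powr_add[symmetric] power2_eq_square)
  finally have tau: "2 / \<tau>\<^sup>2 \<le> 2 * 2 powr (2 * u)" .
  have "1 \<le> 2 powr u"
    using assms(1) by (intro ge_one_powr_ge_zero) auto
  then have "real (nat \<lceil>2 powr u\<rceil>) \<le> 2 * 2 powr u"
    by linarith
  then have "real (nat \<lceil>2 powr u\<rceil>) * (2 / \<tau>\<^sup>2) \<le> (2 * 2 powr u) * (2 * 2 powr (2 * u))"
    using tau by (intro mult_mono) auto
  also have "\<dots> = 4 * 2 powr (3 * u)"
    by (simp add: powr_add[symmetric])
  finally have "real (nat \<lceil>2 powr u\<rceil>) * (2 / \<tau>\<^sup>2) + 1 \<le> 8 * 2 powr (3 * u)"
    using ge_one_powr_ge_zero[of 2 "3 * u"] assms(1) by linarith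
  also have "\<dots> = 2 powr (3 * u + 3)"
    by (simp add: powr_add)
  also have "\<dots> \<le> 2 powr (real m - 1)"
  proof -
    \<comment> \<open>Here \<open>u \<ge> 5\<close> yields
      \<open>u\<^sup>2 - 2 \<ge> 5 * u - 2 \<ge> 3 * u + 3\<close>.\<close>
    have "5 * u \<le> u * u"
      using assms(1) by (intro mult_right_mono) auto
    then have "3 * u + 3 \<le> real m - 1"
      using assms(1,3) unfolding power2_eq_square by linarith
    then show ?thesis
      by simp
  qed
  also have "\<dots> = 1 / 2 * 2 ^ m"
    by (simp add: powr_diff powr_realpow)
  also have "\<dots> < 2 / 3 * 2 ^ m"
    by simp
  finally show ?thesis .
qed

theorem theorem4p1:
  shows "\<exists>C_fam>0. \<exists>C_ball>0. \<exists>C_samp>0. \<exists>k_time::nat.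
         \<exists>c_rad>0. \<exists>c_err>0. \<exists>c_lrad>0. \<exists>c_query>0. \<exists>c_prec>0. \<exists>\<rho>\<^sub>0>0. \<exists>\<gamma>\<^sub>0>0.
    \<forall>\<rho> \<gamma> :: real. 0 < \<rho> \<and> \<rho> < \<rho>\<^sub>0 \<and> 0 < \<gamma> \<and> \<gamma> < \<gamma>\<^sub>0 \<longrightarrow>
      (\<exists>(F :: nat \<Rightarrow> dist_pair set) (\<eta> :: nat \<Rightarrow> real) d\<^sub>0.
         \<eta> \<longlonglongrightarrow> 0 \<and>
         (\<forall>d\<ge>d\<^sub>0.
            finite (F d) \<and> F d \<noteq> {} \<and>
            real (card (F d)) \<le> 2 powr (real d powr C_fam) \<and>
            (\<forall>D\<in>F d. is_dist_pair d D) \<and>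
            \<comment> \<open>(1)\<close>
            (\<forall>D\<in>F d. \<exists>a\<in>space (euclid d). \<forall>i.
               measure (D i) {x \<in> space (euclid d).
                 L2_set (\<lambda>j. x j - a j) {..<d} \<le> C_ball * sqrt (real d)} \<ge> 1 - \<eta> d) \<and>
            \<comment> \<open>(2)\<close>
            (\<forall>D\<in>F d. \<exists>f.
               is_robust d (c_rad * sqrt (1 / \<gamma>)) (2 powr - (real d powr (c_err * \<gamma>))) D f) \<and>
            (\<exists>n. real n \<le> C_samp * real d \<and>
               robustly_learnable d (c_lrad * sqrt (1 / \<gamma>)) 0.01 (F d) n) \<and>
            \<comment> \<open>(3)\<close>
            (\<forall>D\<in>F d. \<exists>w b. separates d D (linear_classifier d w b)) \<and>
            \<comment> \<open>(4)\<close>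
            (\<forall>\<epsilon>>\<rho>. \<forall>\<tau> \<ge> 2 powr - (real d powr (c_prec * \<gamma>)). \<forall>A.
               (\<forall>\<omega>. sq_tree_valid d (A \<omega>)) \<and> sq_learns d \<tau> \<epsilon> 0.01 (F d) A \<longrightarrow>
               sq_makes_at_least d \<tau> (F d) A (2 powr (real d powr c_query)))) \<and>
         \<comment> \<open>(3), the learning algorithm, uniform in the dimension\<close>
         separator_learnable_in_time k_time d\<^sub>0 F)"
proof -
  define m where "m d = nat \<lfloor>sqrt (real d)\<rfloor>" for d :: nat
  define R where "R d = real d powr (1/4)" for d :: nat
  \<comment> \<open>The radius \<open>sqrt m * R\<close> stays below \<open>sqrt d\<close>, while \<open>R\<close> outgrows every constant \<open>sqrt (1 / \<gamma>)\<close>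
      and \<open>m\<close> outgrows every multiple of \<open>d powr (1/4)\<close>.\<close>
  have main: "\<exists>(F :: nat \<Rightarrow> dist_pair set) (\<eta> :: nat \<Rightarrow> real) d\<^sub>0.
         \<eta> \<longlonglongrightarrow> 0 \<and>
         (\<forall>d\<ge>d\<^sub>0.
            finite (F d) \<and> F d \<noteq> {} \<and>
            real (card (F d)) \<le> 2 powr (real d powr 1) \<and>
            (\<forall>D\<in>F d. is_dist_pair d D) \<and>
            (\<forall>D\<in>F d. \<exists>a\<in>space (euclid d). \<forall>i.
               measure (D i) {x \<in> space (euclid d).
                 L2_set (\<lambda>j. x j - a j) {..<d} \<le> 2 * sqrt (real d)} \<ge> 1 - \<eta> d) \<and>
            (\<forall>D\<in>F d. \<exists>f.
               is_robust d (1 * sqrt (1 / \<gamma>)) (2 powr - (real d powr (1 * \<gamma>))) D f) \<and>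
            (\<exists>n. real n \<le> 1 * real d \<and>
               robustly_learnable d (1 * sqrt (1 / \<gamma>)) 0.01 (F d) n) \<and>
            (\<forall>D\<in>F d. \<exists>w b. separates d D (linear_classifier d w b)) \<and>
            (\<forall>\<epsilon>>\<rho>. \<forall>\<tau> \<ge> 2 powr - (real d powr (1/4 * \<gamma>)). \<forall>A.
               (\<forall>\<omega>. sq_tree_valid d (A \<omega>)) \<and> sq_learns d \<tau> \<epsilon> 0.01 (F d) A \<longrightarrow>
               sq_makes_at_least d \<tau> (F d) A (2 powr (real d powr (1/4))))) \<and>
         separator_learnable_in_time 1 d\<^sub>0 F"
    if \<rho>: "0 < \<rho>" "\<rho> < 1" and \<gamma>: "0 < \<gamma>" "\<gamma> < 1" for \<rho> \<gamma> :: real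
  proof -
    define F where "F d = hidden_parity.parity_pair d (m d) (R d) \<rho> ` Pow {0<..m d}" for d
    \<comment> \<open>The 5 is what the query count needs, and
      \<open>sqrt (1 / \<gamma>) + 1\<close> keeps the robustness radius strictly below
      \<open>R d\<close>. As \<open>R\<close> is a fourth root, \<open>d \<ge> K ^ 4\<close> gives
      \<open>R d \<ge> K\<close>.\<close>
    define K where "K = max 5 (sqrt (1 / \<gamma>) + 1)"
    define d\<^sub>0 where "d\<^sub>0 = nat \<lceil>K ^ 4\<rceil>"
    have scales: "5 \<le> R d" "sqrt (1 / \<gamma>) < R d" "(R d)\<^sup>2 = sqrt (real d)" "1 \<le> real d"
      "real (m d) \<le> sqrt (real d)" "sqrt (real d) - 1 \<le> real (m d)" "hidden_parity d (m d) (R d) \<rho>"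
      if "d\<^sub>0 \<le> d" for d
    proof -
      have K: "5 \<le> K"
        by (simp add: K_def)
      have "K ^ 4 \<le> real d"
        using that unfolding d\<^sub>0_def by linarith
      then have "(K ^ 4) powr (1/4) \<le> R d"
        unfolding R_def using K by (intro powr_mono2) auto
      moreover have "(K ^ 4) powr (1/4) = K"
        using K powr_powr[of K 4 "1/4"] by simp
      ultimately have "K \<le> R d"
        by simp
      then show R5: "5 \<le> R d" "sqrt (1 / \<gamma>) < R d"
        using K by (auto simp: K_def)
      show d1: "1 \<le> real d"
        using \<open>K ^ 4 \<le> real d\<close> one_le_power[of K 4] K by linarith
      show R2: "(R d)\<^sup>2 = sqrt (real d)"
        using d1 by (simp add: R_def power2_eq_square powr_add[symmetric] powr_half_sqrt)
      show m1: "real (m d) \<le> sqrt (real d)" and "sqrt (real d) - 1 \<le> real (m d)"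
        unfolding m_def using real_sqrt_ge_zero[of "real d"] by linarith+
      have "5 * 5 \<le> R d * R d"
        using R5(1) by (intro mult_mono) auto
      then have "25 \<le> sqrt (real d)"
        using R2 by (simp add: power2_eq_square)
      then have "25 * sqrt (real d) \<le> sqrt (real d) * sqrt (real d)"
        by (intro mult_right_mono) auto
      then have "real (m d) + 2 \<le> real d"
        using m1 \<open>25 \<le> sqrt (real d)\<close> by simp
      then show "hidden_parity d (m d) (R d) \<rho>"
        using R5(1) \<rho>(1) by unfold_locales linarith+
    qed
    \<comment> \<open>The ball holds all the mass, so \<open>\<eta>\<close> is constantly 0; the
      form \<open>1 - 0\<close> is kept to match \<open>1 - \<eta> d\<close>.\<close>
    have properties: "finite (F d) \<and> F d \<noteq> {} \<and>
            real (card (F d)) \<le> 2 powr (real d powr 1) \<and>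
            (\<forall>D\<in>F d. is_dist_pair d D) \<and>
            (\<forall>D\<in>F d. \<exists>a\<in>space (euclid d). \<forall>i.
               measure (D i) {x \<in> space (euclid d).
                 L2_set (\<lambda>j. x j - a j) {..<d} \<le> 2 * sqrt (real d)} \<ge> 1 - 0) \<and>
            (\<forall>D\<in>F d. \<exists>f.
               is_robust d (1 * sqrt (1 / \<gamma>)) (2 powr - (real d powr (1 * \<gamma>))) D f) \<and>
            (\<exists>n. real n \<le> 1 * real d \<and>
               robustly_learnable d (1 * sqrt (1 / \<gamma>)) 0.01 (F d) n) \<and>
            (\<forall>D\<in>F d. \<exists>w b. separates d D (linear_classifier d w b)) \<and>
            (\<forall>\<epsilon>>\<rho>. \<forall>\<tau> \<ge> 2 powr - (real d powr (1/4 * \<gamma>)). \<forall>A.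
               (\<forall>\<omega>. sq_tree_valid d (A \<omega>)) \<and> sq_learns d \<tau> \<epsilon> 0.01 (F d) A \<longrightarrow>
               sq_makes_at_least d \<tau> (F d) A (2 powr (real d powr (1/4))))"
      if d: "d\<^sub>0 \<le> d" for d
    proof -
      note s = scales[OF d]
      interpret hidden_parity d "m d" "R d" \<rho>
        by (rule s(7))
      have F: "F d = parity_pair ` bits"
        by (simp add: F_def)
      have card: "real (card (F d)) \<le> 2 powr (real d powr 1)"
      proof -
        have "card (F d) \<le> 2 ^ m d"
          unfolding F using card_image_le[OF finite_bits] card_bits by metis
        also have "\<dots> \<le> 2 ^ d"
          using dim by (intro power_increasing) auto
        finally have "real (card (F d)) \<le> real (2 ^ d)"
          by (rule of_nat_mono)
        then show ?thesis
          using s(4) by (simp add: powr_realpow)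
      qed
      have ball: "\<exists>a\<in>space (euclid d). \<forall>i. measure (parity_pair S i) {x \<in> space (euclid d).
                 L2_set (\<lambda>j. x j - a j) {..<d} \<le> 2 * sqrt (real d)} \<ge> 1 - 0" for S
      proof -
        have "real (m d) * sqrt (real d) \<le> sqrt (real d) * sqrt (real d)"
          using s(5) by (intro mult_right_mono) auto
        moreover have "1 * sqrt (real d) \<le> sqrt (real d) * sqrt (real d)"
          using s(4) by (intro mult_right_mono) auto
        moreover have "\<rho>\<^sup>2 \<le> 1"
          using \<rho> by (simp add: power_le_one)
        ultimately have "real (m d) * (R d)\<^sup>2 + (R d)\<^sup>2 + \<rho>\<^sup>2 \<le> (2 * sqrt (real d))\<^sup>2"
          using s(3,4) by (simp add: power_mult_distrib)
        from measure_ball_parity_pair[OF this] show ?thesis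
          by (intro bexI[of _ "\<lambda>j\<in>{..<d}. 0"]) (auto simp: space_euclid_iff)
      qed
      have robust: "is_robust d (1 * sqrt (1 / \<gamma>)) (2 powr - (real d powr (1 * \<gamma>))) (parity_pair S)
          (parity_classifier S)" for S
        using s(2) by (intro robust_parity_classifier) auto
      \<comment> \<open>With \<open>m d + 2\<close> samples the union bound is
        \<open>2 ^ m * (1 / 2) ^ (m + 2) = 1/4\<close>, below the allowed 1/3.\<close>
      have learnable: "real (m d + 2) \<le> 1 * real d \<and>
          robustly_learnable d (1 * sqrt (1 / \<gamma>)) 0.01 (F d) (m d + 2)"
      proof
        show "real (m d + 2) \<le> 1 * real d"
          using dim by linarith
        show "robustly_learnable d (1 * sqrt (1 / \<gamma>)) 0.01 (F d) (m d + 2)"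
          unfolding F using s(2)
          by (intro robustly_learnable_parities) (auto simp: power_add power_divide)
      qed
      have separable: "separates d (parity_pair S) (linear_classifier d ((\<lambda>_. 0)(0 := 1)) 0)" for S
        by (rule separates_parity_pair) auto
      have hard: "sq_makes_at_least d \<tau> (F d) A (2 powr (real d powr (1/4)))"
        if "\<rho> < \<epsilon>" and \<tau>: "2 powr - (real d powr (1/4 * \<gamma>)) \<le> \<tau>"
          and A: "\<forall>\<omega>. sq_tree_valid d (A \<omega>)" "sq_learns d \<tau> \<epsilon> 0.01 (F d) A" for \<epsilon> \<tau> A
      proof (rule ccontr)
        assume few: "\<not> ?thesis"
        \<comment> \<open>Since \<open>\<gamma> < 1\<close>, the permitted precision is never finer
          than \<open>2 powr - R d\<close>.\<close>
        have "real d powr (1/4 * \<gamma>) \<le> R d"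
          unfolding R_def using s(4) \<gamma> by (intro powr_mono) auto
        then have "2 powr - R d \<le> 2 powr - (real d powr (1/4 * \<gamma>))"
          by simp
        then have \<tau>': "2 powr - R d \<le> \<tau>"
          using \<tau> by linarith
        have "0 < \<tau>"
          using \<tau>' powr_gt_zero[of 2 "- R d"] by linarith
        with that few have "2 / 3 * 2 ^ m d \<le> real (nat \<lceil>2 powr R d\<rceil>) * (2 / \<tau>\<^sup>2) + 1"
          unfolding F R_def[of d, symmetric] by (intro sq_query_lower_bound[of \<tau> \<epsilon> A]) auto
        with parity_count_exceeds_sq_bound[OF s(1) \<tau>', of "m d"] s(3,6) show False
          by linarith
      qed
      have "finite (F d)" "F d \<noteq> {}"
        using finite_bits by (auto simp: F)
      moreover have "\<forall>D\<in>F d. is_dist_pair d D"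
        using is_dist_pair_parity_pair by (auto simp: F)
      moreover have "\<forall>D\<in>F d. \<exists>a\<in>space (euclid d). \<forall>i.
               measure (D i) {x \<in> space (euclid d).
                 L2_set (\<lambda>j. x j - a j) {..<d} \<le> 2 * sqrt (real d)} \<ge> 1 - 0"
        using ball unfolding F by blast
      moreover have "\<forall>D\<in>F d. \<exists>f.
               is_robust d (1 * sqrt (1 / \<gamma>)) (2 powr - (real d powr (1 * \<gamma>))) D f"
        using robust unfolding F by blast
      moreover have "\<forall>D\<in>F d. \<exists>w b. separates d D (linear_classifier d w b)"
        using separable unfolding F by blast
      ultimately show ?thesis
        using card learnable hard by blast
    qed
    have "separator_learnable_in_time 1 d\<^sub>0 F"
      unfolding separator_learnable_in_time_def
    \<comment> \<open>One instruction serves every dimension: cell 0 holds weight 1, and cell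
      \<open>d\<close>, still 0 because \<open>d\<close> is positive, is the threshold. A budget of
      \<open>d ^ 1\<close> steps suffices.\<close>
    proof (intro exI[of _ "[RSet 1 1]"] allI impI conjI ballI)
      fix d assume d: "d\<^sub>0 \<le> d"
      interpret hidden_parity d "m d" "R d" \<rho>
        by (rule scales(7)[OF d])
      have pos: "0 < d" "0 < d ^ 1"
        using dim by auto
      note run = ram_run_separator[OF pos]
      show "length [RSet 1 1] \<le> pc (ram_run [RSet 1 1] d (d ^ 1) (d ^ 1) \<omega> s)" for \<omega> s
        by (simp only: run) simp
      fix D assume "D \<in> F d"
      then obtain S where D: "D = parity_pair S"
        by (auto simp: F_def)
      show "holds_with_prob (coin_space \<Otimes>\<^sub>M sample_space D (d ^ 1)) (2 / 3)
          (\<lambda>(\<omega>, s). separates d D (ram_output d (ram_run [RSet 1 1] d (d ^ 1) (d ^ 1) \<omega> s)))"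
      proof (rule holds_with_prob_always)
        show "prob_space (coin_space \<Otimes>\<^sub>M sample_space D (d ^ 1))"
          unfolding D by (intro prob_space_pair prob_space_coin_space prob_space_sample_space
              prob_space_parity_pair)
        have "ram_output d (ram_run [RSet 1 1] d (d ^ 1) (d ^ 1) \<omega> s)
            = linear_classifier d ((\<lambda>_. 0)(0 := 1)) 0" for \<omega> s
          unfolding ram_output_def run using pos by simp
        moreover have "separates d D (linear_classifier d ((\<lambda>_. 0)(0 := 1)) 0)"
          unfolding D by (rule separates_parity_pair) auto
        ultimately show "case p of (\<omega>, s) \<Rightarrow>
            separates d D (ram_output d (ram_run [RSet 1 1] d (d ^ 1) (d ^ 1) \<omega> s))" for p
          by (cases p) simp
      qed simp
    qed
    then show ?thesis
      using properties by (intro exI[of _ F] exI[of _ "\<lambda>_. 0"] exI[of _ d\<^sub>0]) auto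
  qed
  show ?thesis
    \<comment> \<open>The witnesses follow the quantifier order; the two values 1/4 are
      \<open>c_query\<close> and \<open>c_prec\<close>, matching the exponent in
      \<open>R\<close>.\<close>
    by (rule exI[of _ 1], rule conjI, simp, rule exI[of _ 2], rule conjI, simp,
        rule exI[of _ 1], rule conjI, simp, rule exI[of _ 1],
        rule exI[of _ 1], rule conjI, simp, rule exI[of _ 1], rule conjI, simp,
        rule exI[of _ 1], rule conjI, simp, rule exI[of _ "1/4"], rule conjI, simp,
        rule exI[of _ "1/4"], rule conjI, simp, rule exI[of _ 1], rule conjI, simp,
        rule exI[of _ 1], rule conjI, simp, intro allI impI, elim conjE, rule main)
qed

end
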